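(* For every polynomial $p(x)$, $$\int_{\mathbb{Z}_p}\zeta^{\xi}p(x+\xi)\,d\mu_{-q}(\xi)=\left(\int_{\mathbb{Z}_p}\zeta^{\xi}e^{\xi t}\,d\mu_{-q}(\xi)\right)p(x)=\frac{[2]_q}{\zeta q e^{t}+1}\,p(x).$$ That is, for $n\ge0$, $E_{n,\zeta}^q(x)=\left(\int_{\mathbb{Z}_p}\zeta^{\xi}e^{\xi t}\,d\mu_{-q}(\xi)\right)x^n=\frac{[2]_q}{\zeta q e^{t}+1}x^n$.
   Context: Let $p$ be an odd prime, $\mathbb{C}_p$ the completion of an algebraic closure of $\mathbb{Q}_p$, $q\in\mathbb{C}_p$ with $|q-1|_p<1$, $\zeta\in\mathbb{C}_p$ with $|1-\zeta|_p<1$, $[2]_q=1+q$ and $[x]_{-q}=\frac{1-(-q)^x}{1+q}$. For uniformly differentiable $f$ on $\mathbb{Z}_p$, $\int_{\mathbb{Z}_p}\zeta^{\xi}f(\xi)d\mu_{-q}(\xi)=\lim_{n\to\infty}\frac{1}{[p^n]_{-q}}\sum_{\xi=0}^{p^n-1}\zeta^\xi f(\xi)(-1)^\xi q^\xi$; the integral of $e^{\xi t}$ is the formal power series $\sum_n\left(\int\zeta^\xi\xi^n d\mu_{-q}(\xi)\right)t^n/n!$. The weighted $q$-Euler polynomials are defined by $\frac{[2]_q}{q\zeta e^{t}+1}e^{tx}=\sum_{n\ge0}E_{n,\zeta}^{q}(x)\frac{t^n}{n!}$. Umbral calculus: a formal power series $h(t)=\sum_k a_k t^k/k!$ acts on polynomials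 as the operator $h(t)p(x)=\sum_k \frac{a_k}{k!}p^{(k)}(x)$, i.e. $t^kp(x)=p^{(k)}(x)$ and $e^{yt}p(x)=p(x+y)$. *)

theory Defs
  imports "HOL-Analysis.Analysis" "HOL-Computational_Algebra.Computational_Algebra"
begin

text \<open>
  The library constrains \<open>norm\<close> to real normed vector spaces, so the absolute value is a class
  parameter of its own. Definiteness follows from the metric axioms.
\<close>

class nonarch_valued_field = field_char_0 + metric_space +
  fixes absval :: "'a \<Rightarrow> real"
  assumes dist_absval: "dist x y = absval (x - y)"
    and absval_mult: "absval (x * y) = absval x * absval y"
    and absval_add_le_max: "absval (x + y) \<le> max (absval x) (absval y)"

definition padic_abs :: "nat \<Rightarrow> rat \<Rightarrow> real" where
  "padic_abs p r =
    (if r = 0 then 0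
     else case quotient_of r of (a, b) \<Rightarrow>
       real p powi (int (multiplicity (int p) b) - int (multiplicity (int p) a)))"

definition algebraic_over :: "'a :: field set \<Rightarrow> 'a \<Rightarrow> bool" where
  "algebraic_over S x \<longleftrightarrow> (\<exists>f. f \<noteq> 0 \<and> (\<forall>i. coeff f i \<in> S) \<and> poly f x = 0)"

text \<open>
  In a complete valued field that restricts to the \<open>p\<close>-adic absolute value on the rationals,
  the closure of the rationals is their completion, i.e. the field of \<open>p\<close>-adic numbers.
\<close>

definition padic_numbers :: "'a :: nonarch_valued_field set" where
  "padic_numbers = closure \<rat>"

definition padic_algebraic_numbers :: "'a :: nonarch_valued_field set" where
  "padic_algebraic_numbers = {x. algebraic_over padic_numbers x}"

text \<open>
  The type \<open>'a\<close> is the completion of an algebraic closure of the \<open>p\<close>-adic numbers: it is complete,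
  its absolute value extends the \<open>p\<close>-adic one, and the elements algebraic over the \<open>p\<close>-adic numbers
  form an algebraically closed field that is dense. This determines \<open>'a\<close> up to isometric
  isomorphism.
\<close>

definition padic_complex_field :: "nat \<Rightarrow> 'a :: nonarch_valued_field itself \<Rightarrow> bool" where
  "padic_complex_field p _ \<longleftrightarrow>
     complete (UNIV :: 'a set) \<and>
     (\<forall>r. absval (of_rat r :: 'a) = padic_abs p r) \<and>
     (\<forall>f :: 'a poly. degree f > 0 \<and> (\<forall>i. coeff f i \<in> padic_algebraic_numbers) \<longrightarrow>
        (\<exists>x \<in> padic_algebraic_numbers. poly f x = 0)) \<and>
     closure (padic_algebraic_numbers :: 'a set) = UNIV"

definition neg_q_number :: "'a :: field \<Rightarrow> nat \<Rightarrow> 'a" where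
  "neg_q_number q n = (1 - (- q) ^ n) / (1 + q)"

text \<open>
  The sums only involve the values of \<open>f\<close> at natural numbers, so a function on the \<open>p\<close>-adic integers
  may be given by any extension to the whole field.
\<close>

definition fermionic_sum ::
    "nat \<Rightarrow> 'a :: field \<Rightarrow> 'a \<Rightarrow> ('a \<Rightarrow> 'a) \<Rightarrow> nat \<Rightarrow> 'a" where
  "fermionic_sum p q \<zeta> f n =
     1 / neg_q_number q (p ^ n) * (\<Sum>\<xi><p ^ n. \<zeta> ^ \<xi> * f (of_nat \<xi>) * (- 1) ^ \<xi> * q ^ \<xi>)"

definition fermionic_integrable ::
    "nat \<Rightarrow> 'a :: nonarch_valued_field \<Rightarrow> 'a \<Rightarrow> ('a \<Rightarrow> 'a) \<Rightarrow> bool" where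
  "fermionic_integrable p q \<zeta> f \<longleftrightarrow> convergent (fermionic_sum p q \<zeta> f)"

definition fermionic_integral ::
    "nat \<Rightarrow> 'a :: nonarch_valued_field \<Rightarrow> 'a \<Rightarrow> ('a \<Rightarrow> 'a) \<Rightarrow> 'a" where
  "fermionic_integral p q \<zeta> f = lim (fermionic_sum p q \<zeta> f)"

text \<open>The integral of \<open>exp (\<xi> t)\<close>, as a formal power series in \<open>t\<close>.\<close>

definition fermionic_integral_exp ::
    "nat \<Rightarrow> 'a :: nonarch_valued_field \<Rightarrow> 'a \<Rightarrow> 'a fps" where
  "fermionic_integral_exp p q \<zeta> =
     Abs_fps (\<lambda>n. fermionic_integral p q \<zeta> (\<lambda>\<xi>. \<xi> ^ n) / fact n)"

definition q_euler_series :: "'a :: field_char_0 \<Rightarrow> 'a \<Rightarrow> 'a fps" where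
  "q_euler_series q \<zeta> = fps_const (1 + q) / (fps_const (q * \<zeta>) * fps_exp 1 + 1)"

text \<open>
  The generating series is multiplied by \<open>exp (t x)\<close> in the ring of formal power series in \<open>t\<close> over the
  polynomials in \<open>x\<close>.
\<close>

definition q_euler_poly :: "'a :: field_char_0 \<Rightarrow> 'a \<Rightarrow> nat \<Rightarrow> 'a poly" where
  "q_euler_poly q \<zeta> n =
     smult (fact n)
       (fps_nth (Abs_fps (\<lambda>k. [:fps_nth (q_euler_series q \<zeta>) k:]) *
                 Abs_fps (\<lambda>k. monom (1 / fact k) k)) n)"

text \<open>
  The coefficient of \<open>t ^ k\<close> in \<open>h\<close> is \<open>a\<^sub>k / k!\<close>. The sum stops at the degree because all higher
  derivatives vanish.
\<close>

definition umbral_op :: "'a :: field_char_0 fps \<Rightarrow> 'a poly \<Rightarrow> 'a poly" where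
  "umbral_op h P = (\<Sum>k\<le>degree P. smult (fps_nth h k) ((pderiv ^^ k) P))"

end

theory Submission imports Defs begin

text \<open>
  Put \<open>w = q * \<zeta>\<close> and \<open>N = p ^ n\<close>. Since \<open>N\<close> is odd, shifting the summation index in the sum of
  \<open>(- w) ^ \<xi> * f \<xi>\<close> over \<open>\<xi> < N\<close> gives \<open>w * S (f (\<cdot> + 1)) + S f = f 0 + w ^ N * f N\<close>. In the
  limit \<open>w ^ N \<longlonglongrightarrow> 1\<close> and \<open>N \<longlonglongrightarrow> 0\<close>, while the normalizing factor \<open>(1 + q) / (1 + q ^ N)\<close>
  tends to \<open>(1 + q) / 2\<close>. For \<open>f = (\<lambda>\<xi>. \<xi> ^ m)\<close> this is a recursion which yields
  the existence of all moments, because \<open>1 + w \<noteq> 0\<close>, and which says that their exponential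
  generating series \<open>h\<close> satisfies \<open>(w * exp t + 1) * h = 1 + q\<close>. The rest is Taylor expansion.
\<close>

subsection \<open>Nonarchimedean absolute values\<close>

lemma absval_zero [simp]: "absval (0 :: 'a :: nonarch_valued_field) = 0"
  using dist_absval[of "0::'a" 0] by simp

lemma absval_nonneg [simp]: "absval (x :: 'a :: nonarch_valued_field) \<ge> 0"
  using dist_absval[of x 0] zero_le_dist[of x 0] by simp

lemma absval_eq_0_iff [simp]: "absval (x :: 'a :: nonarch_valued_field) = 0 \<longleftrightarrow> x = 0"
  using dist_absval[of x 0] dist_eq_0_iff[of x 0] by simp

lemma absval_one [simp]: "absval (1 :: 'a :: nonarch_valued_field) = 1"
  using absval_mult[of "1::'a" 1] absval_eq_0_iff[of "1::'a"] by simp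

lemma absval_minus_commute: "absval (x - y :: 'a :: nonarch_valued_field) = absval (y - x)"
  by (metis dist_absval dist_commute)

lemma absval_power: "absval (x ^ n :: 'a :: nonarch_valued_field) = absval x ^ n"
  by (induction n) (simp_all add: absval_mult)

lemma absval_of_nat_le_1: "absval (of_nat n :: 'a :: nonarch_valued_field) \<le> 1"
proof (induction n)
  case (Suc n)
  have "absval (of_nat (Suc n) :: 'a) \<le> max (absval (of_nat n :: 'a)) (absval (1::'a))"
    using absval_add_le_max[of "of_nat n :: 'a" 1] by (simp add: add.commute)
  with Suc show ?case by simp
qed simp

lemma absval_add_le:
  "absval x \<le> c \<Longrightarrow> absval y \<le> c \<Longrightarrow> absval (x + y :: 'a :: nonarch_valued_field) \<le> c"
  using absval_add_le_max[of x y] by linarith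

lemma absval_sum_le:
  fixes f :: "'b \<Rightarrow> 'a :: nonarch_valued_field"
  assumes "c \<ge> 0" "\<And>i. i \<in> A \<Longrightarrow> absval (f i) \<le> c"
  shows "absval (sum f A) \<le> c"
  using assms by (induction A rule: infinite_finite_induct) (auto intro!: absval_add_le)

lemma absval_minus: "absval (- x :: 'a :: nonarch_valued_field) = absval x"
  using absval_minus_commute[of 0 x] by simp

text \<open>The isosceles principle: the ultrametric inequality for \<open>x = (x - y) + y\<close>
  bounds \<open>absval x\<close> above, and for \<open>y = (y - x) + x\<close> it bounds it
  below.\<close>

lemma absval_eq_1:
  fixes x y :: "'a :: nonarch_valued_field"
  assumes "absval (x - y) < 1" "absval y = 1"
  shows "absval x = 1"
  using assms absval_add_le_max[of "x - y" y] absval_add_le_max[of "y - x" x]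
    absval_minus_commute[of x y]
  by auto

lemma absval_mult_diff_1_less:
  fixes x y :: "'a :: nonarch_valued_field"
  assumes "absval (x - 1) < 1" "absval (y - 1) < 1"
  shows "absval (x * y - 1) < 1"
proof -
  have "absval x = 1"
    using absval_eq_1[of x 1] assms by simp
  then have "absval (x * (y - 1)) < 1"
    using assms by (simp add: absval_mult)
  then have "absval (x * (y - 1) + (x - 1)) < 1"
    using absval_add_le_max[of "x * (y - 1)" "x - 1"] assms by linarith
  then show ?thesis
    by (simp add: algebra_simps)
qed

text \<open>In \<open>u ^ n - 1 = (u - 1) * (\<Sum>i<n. u ^ i)\<close> every \<open>u ^ i\<close> is
  close to 1, so the geometric sum is \<open>n\<close> up to an error of size at most
  \<open>absval (u - 1)\<close>. For \<open>n = p\<close> both arguments of \<open>max\<close> are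
  below 1 in the application, so taking \<open>p\<close>-th powers contracts towards 1.\<close>

lemma absval_power_diff_1_le:
  fixes u :: "'a :: nonarch_valued_field"
  assumes "absval (u - 1) < 1"
  shows "absval (u ^ n - 1) \<le> absval (u - 1) * max (absval (of_nat n :: 'a)) (absval (u - 1))"
proof -
  have u: "absval u = 1"
    using absval_eq_1[of u 1] assms by simp
  have geometric: "u ^ m - 1 = (u - 1) * (\<Sum>i<m. u ^ i)" for m
    by (rule power_diff_1_eq)
  \<comment> \<open>A crude first bound: the geometric sum has absolute value at most 1. It is then
    fed back into the sum for the sharper estimate.\<close>
  have "absval (u ^ i - 1) \<le> absval (u - 1)" for i
    unfolding geometric absval_mult
    by (intro mult_left_le absval_sum_le) (simp_all add: u absval_power)
  then have "absval (\<Sum>i<n. u ^ i - 1) \<le> absval (u - 1)"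
    by (intro absval_sum_le) simp_all
  moreover have "(\<Sum>i<n. u ^ i) = of_nat n + (\<Sum>i<n. u ^ i - 1)"
    by (simp add: sum_subtractf)
  ultimately have "absval (\<Sum>i<n. u ^ i) \<le> max (absval (of_nat n :: 'a)) (absval (u - 1))"
    using absval_add_le_max[of "of_nat n :: 'a" "\<Sum>i<n. u ^ i - 1"] by auto
  then show ?thesis
    unfolding geometric absval_mult by (intro mult_left_mono) simp_all
qed

section \<open>Continuity of the field operations\<close>

lemma tendsto_iff_absval:
  "(f \<longlongrightarrow> (l :: 'a :: nonarch_valued_field)) F \<longleftrightarrow> ((\<lambda>x. absval (f x - l)) \<longlongrightarrow> 0) F"
  by (subst tendsto_dist_iff) (simp add: dist_absval)

text \<open>Makes \<open>tendsto_add\<close> and \<open>tendsto_sum\<close> applicable; the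
  ultrametric inequality bounds the error of a sum by the larger of the two errors.\<close>

instance nonarch_valued_field \<subseteq> topological_comm_monoid_add
proof
  fix a b :: 'a
  let ?F = "nhds a \<times>\<^sub>F nhds b"
  have "(fst \<longlongrightarrow> a) ?F" "(snd \<longlongrightarrow> b) ?F"
    by (simp_all add: filterlim_fst filterlim_snd)
  then have "((\<lambda>x. max (absval (fst x - a)) (absval (snd x - b))) \<longlongrightarrow> max 0 0) ?F"
    unfolding tendsto_iff_absval by (rule tendsto_max)
  then have "((\<lambda>x. max (absval (fst x - a)) (absval (snd x - b))) \<longlongrightarrow> 0) ?F"
    by simp
  then have "((\<lambda>x. absval (fst x + snd x - (a + b))) \<longlongrightarrow> 0) ?F"
    by (rule tendsto_sandwich[OF _ _ tendsto_const, rotated 2])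
      (auto intro!: always_eventually simp: add_diff_add absval_add_le_max)
  then show "((\<lambda>x. fst x + snd x) \<longlongrightarrow> a + b) ?F"
    by (simp add: tendsto_iff_absval)
qed

instance nonarch_valued_field \<subseteq> topological_semigroup_mult
proof
  fix a b :: 'a
  let ?F = "nhds a \<times>\<^sub>F nhds b"
  have "(fst \<longlongrightarrow> a) ?F" "(snd \<longlongrightarrow> b) ?F"
    by (simp_all add: filterlim_fst filterlim_snd)
  then have "((\<lambda>x. absval (fst x - a)) \<longlongrightarrow> 0) ?F" "((\<lambda>x. absval (snd x - b)) \<longlongrightarrow> 0) ?F"
    by (simp_all add: tendsto_iff_absval)
  then have "((\<lambda>x. absval (fst x - a) * absval (snd x - b) + (absval a * absval (snd x - b)
      + absval (fst x - a) * absval b)) \<longlongrightarrow> 0 * 0 + (absval a * 0 + 0 * absval b)) ?F"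
    (is "(?g \<longlongrightarrow> _) _")
    by (intro tendsto_intros)
  then have g: "(?g \<longlongrightarrow> 0) ?F"
    by simp
  \<comment> \<open>Expansion of the product around \<open>(a, b)\<close>; the ultrametric
    inequality is weakened to the triangle inequality to match the sum \<open>?g\<close>.\<close>
  have le: "absval (fst z * snd z - a * b) \<le> ?g z" for z
  proof -
    have "fst z * snd z - a * b
        = (fst z - a) * (snd z - b) + (a * (snd z - b) + (fst z - a) * b)"
      by (simp add: algebra_simps)
    moreover have "absval (u + v) \<le> absval u + absval v" for u v :: 'a
      by (rule order_trans[OF absval_add_le_max]) simp
    ultimately show ?thesis
      by (smt (verit) absval_mult)
  qed
  have "((\<lambda>x. absval (fst x * snd x - a * b)) \<longlongrightarrow> 0) ?F"
    by (rule tendsto_sandwich[OF always_eventually always_eventually tendsto_const g])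
      (simp_all add: le)
  then show "((\<lambda>x. fst x * snd x) \<longlongrightarrow> a * b) ?F"
    by (simp add: tendsto_iff_absval)
qed

text \<open>Inversion is an isometry on the elements of absolute value 1. The normalizing
  denominators \<open>1 + q ^ (p ^ n)\<close> are of this kind.\<close>

lemma tendsto_inverse_nonarch:
  fixes f :: "'b \<Rightarrow> 'a :: nonarch_valued_field"
  assumes f: "(f \<longlongrightarrow> l) F" and "absval l = 1" and f1: "\<And>x. absval (f x) = 1"
  shows "((\<lambda>x. inverse (f x)) \<longlongrightarrow> inverse l) F"
proof -
  have nz: "f x \<noteq> 0" "l \<noteq> 0" for x
    using assms(2) f1[of x] by force+
  have "absval (inverse (f x) - inverse l) = absval (f x - l)" for x
  proof -
    have "f x - l = f x * l * (inverse l - inverse (f x))"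
      using nz by (simp add: field_simps)
    then show ?thesis
      using assms(2) f1 by (simp add: absval_mult absval_minus_commute)
  qed
  then show ?thesis
    using f by (simp add: tendsto_iff_absval)
qed

subsection \<open>Powers with exponent \<open>p ^ n\<close>\<close>

lemma absval_prime_less_1:
  assumes "prime p" "padic_complex_field p TYPE('a :: nonarch_valued_field)"
  shows "absval (of_nat p :: 'a) < 1"
proof -
  have "absval (of_nat p :: 'a) = absval (of_rat (of_nat p) :: 'a)"
    by simp
  also have "\<dots> = padic_abs p (of_nat p)"
    using assms(2) by (simp only: padic_complex_field_def)
  \<comment> \<open>The reduced fraction is \<open>p / 1\<close>: multiplicity 0 in the denominator
    minus 1 in the numerator.\<close>
  also have "\<dots> = real p powi (- 1)"
    using prime_gt_1_nat[OF assms(1)]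
    by (simp add: padic_abs_def multiplicity_self)
  also have "\<dots> < 1"
    using prime_gt_1_nat[OF assms(1)] by (simp add: power_int_minus inverse_less_1_iff)
  finally show ?thesis .
qed

text \<open>In \<open>1 = p - 2 * k\<close> the term \<open>p\<close> is too small to reach absolute
  value 1, so \<open>2 * k\<close> must, and \<open>absval (of_nat k) \<le> 1\<close> leaves this to
  the factor 2.\<close>

lemma absval_two:
  assumes "odd p" "absval (of_nat p :: 'a :: nonarch_valued_field) < 1"
  shows "absval (2 :: 'a) = 1"
proof -
  obtain k where k: "p = 2 * k + 1"
    using assms(1) by (auto elim: oddE)
  have "of_nat p + - (2 * of_nat k :: 'a) = 1"
    by (simp add: k)
  then have "1 \<le> max (absval (of_nat p :: 'a)) (absval (2::'a) * absval (of_nat k :: 'a))"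
    using absval_add_le_max[of "of_nat p" "- (2 * of_nat k :: 'a)"]
    by (simp only: absval_minus absval_mult absval_one)
  then have "1 \<le> absval (2::'a) * absval (of_nat k :: 'a)"
    using assms(2) by linarith
  also have "\<dots> \<le> absval (2::'a)"
    by (intro mult_left_le absval_of_nat_le_1) simp
  finally show ?thesis
    using absval_of_nat_le_1[of 2, where 'a = 'a] by simp
qed

text \<open>\<open>1 + u\<close> differs from 2 by \<open>u - 1\<close>. This serves both the
  denominators \<open>1 + q ^ (p ^ n)\<close> and the nonvanishing of
  \<open>1 + q * \<zeta>\<close>.\<close>

lemma absval_one_plus:
  fixes u :: "'a :: nonarch_valued_field"
  assumes "absval (2 :: 'a) = 1" "absval (u - 1) < 1"
  shows "absval (1 + u) = 1"
  by (rule absval_eq_1[of _ 2]) (use assms in \<open>simp_all add: algebra_simps\<close>)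

lemma prime_power_tendsto_0:
  assumes "absval (of_nat p :: 'a :: nonarch_valued_field) < 1"
  shows "(\<lambda>n. of_nat (p ^ n) :: 'a) \<longlonglongrightarrow> 0"
  by (auto simp: tendsto_iff_absval absval_power intro!: LIMSEQ_realpow_zero assms)

lemma absval_power_diff_1_less:
  fixes u :: "'a :: nonarch_valued_field"
  assumes "absval (u - 1) < 1"
  shows "absval (u ^ n - 1) < 1"
proof -
  have "absval (u ^ n - 1) \<le> absval (u - 1) * 1"
    by (rule order_trans[OF absval_power_diff_1_le[OF assms]], rule mult_left_mono)
      (use assms absval_of_nat_le_1[of n, where 'a = 'a] in auto)
  with assms show ?thesis
    by simp
qed

text \<open>Each \<open>p\<close>-th power shrinks the distance to 1 by at least the factor
  \<open>c\<close>, which gives geometric convergence.\<close>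

lemma power_prime_power_tendsto_1:
  fixes u :: "'a :: nonarch_valued_field"
  assumes p: "absval (of_nat p :: 'a) < 1" and u: "absval (u - 1) < 1"
  shows "(\<lambda>n. u ^ (p ^ n)) \<longlonglongrightarrow> 1"
proof -
  define c where "c = max (absval (of_nat p :: 'a)) (absval (u - 1))"
  have c: "0 \<le> c" "c < 1"
    using p u by (auto simp: c_def le_max_iff_disj)
  have bound: "absval (u ^ (p ^ n) - 1) \<le> c ^ n * absval (u - 1)" for n
  proof (induction n)
    case (Suc n)
    let ?v = "u ^ (p ^ n)"
    \<comment> \<open>The iterate stays within the initial distance of 1, so the same
      \<open>c\<close> works in every step.\<close>
    have "c ^ n * absval (u - 1) \<le> 1 * absval (u - 1)"
      using c by (intro mult_right_mono power_le_one) auto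
    then have v: "absval (?v - 1) \<le> absval (u - 1)"
      using Suc by simp
    have "absval (?v ^ p - 1) \<le> absval (?v - 1) * max (absval (of_nat p :: 'a)) (absval (?v - 1))"
      using v u by (intro absval_power_diff_1_le) simp
    also have "\<dots> \<le> (c ^ n * absval (u - 1)) * c"
      using Suc v c by (intro mult_mono) (auto simp: c_def le_max_iff_disj)
    finally show ?case
      by (simp add: power_mult[symmetric] mult_ac)
  qed simp
  have lim: "(\<lambda>n. c ^ n * absval (u - 1)) \<longlonglongrightarrow> 0"
    using c by (intro tendsto_mult_left_zero LIMSEQ_realpow_zero) auto
  show ?thesis
    unfolding tendsto_iff_absval
    by (rule tendsto_sandwich[OF always_eventually always_eventually tendsto_const lim])
      (simp_all add: bound)
qed

subsection \<open>Moments of the fermionic integral\<close>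

text \<open>Linearity, in the form used for the binomial expansion of \<open>(\<xi> + 1) ^ m\<close>
  and for the Taylor expansion of \<open>P\<close>.\<close>

lemma fermionic_sum_sum:
  "fermionic_sum p q \<zeta> (\<lambda>\<xi>. \<Sum>k\<in>A. c k * f k \<xi>) n = (\<Sum>k\<in>A. c k * fermionic_sum p q \<zeta> (f k) n)"
proof -
  have "(\<Sum>\<xi><p ^ n. \<zeta> ^ \<xi> * (\<Sum>k\<in>A. c k * f k (of_nat \<xi>)) * (- 1) ^ \<xi> * q ^ \<xi>)
      = (\<Sum>k\<in>A. c k * (\<Sum>\<xi><p ^ n. \<zeta> ^ \<xi> * f k (of_nat \<xi>) * (- 1) ^ \<xi> * q ^ \<xi>))"
    unfolding sum_distrib_left sum_distrib_right
    by (rule trans[OF sum.swap]) (intro sum.cong refl, simp add: mult_ac)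
  then show ?thesis
    by (simp add: fermionic_sum_def sum_distrib_left mult.left_commute)
qed

lemma fermionic_sum_shift:
  fixes q \<zeta> :: "'a :: field"
  assumes "odd p"
  shows "q * \<zeta> * fermionic_sum p q \<zeta> (\<lambda>\<xi>. f (\<xi> + 1)) n + fermionic_sum p q \<zeta> f n
    = (1 + q) * inverse (1 + q ^ (p ^ n)) * (f 0 + (q * \<zeta>) ^ (p ^ n) * f (of_nat (p ^ n)))"
proof -
  define w where "w = q * \<zeta>"
  define g where "g i = (- w) ^ i * f (of_nat i)" for i
  have odd: "odd (p ^ n)"
    using assms by simp
  \<comment> \<open>As \<open>p ^ n\<close> is odd,
    \<open>(- q) ^ (p ^ n) = - (q ^ (p ^ n))\<close>, which turns the normalizing factor into
    \<open>(1 + q) * inverse (1 + q ^ (p ^ n))\<close>.\<close>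
  have fs: "fermionic_sum p q \<zeta> h n
      = (1 + q) * inverse (1 + q ^ (p ^ n)) * (\<Sum>i<p ^ n. (- w) ^ i * h (of_nat i))" for h
  proof -
    have term_eq: "\<zeta> ^ i * h (of_nat i) * (- 1) ^ i * q ^ i = (- w) ^ i * h (of_nat i)" for i
      by (simp add: w_def power_mult_distrib power_minus[of "q * \<zeta>"])
    show ?thesis
      unfolding fermionic_sum_def term_eq
      using odd by (simp add: neg_q_number_def power_minus[of q] divide_inverse)
  qed
  \<comment> \<open>Since \<open>w * (- w) ^ i = - ((- w) ^ Suc i)\<close>, the combination
    telescopes.\<close>
  have "w * (\<Sum>i<p ^ n. (- w) ^ i * f (of_nat i + 1)) + (\<Sum>i<p ^ n. (- w) ^ i * f (of_nat i))
      = (\<Sum>i<p ^ n. g i - g (Suc i))"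
    by (simp add: g_def sum_distrib_left sum.distrib[symmetric] algebra_simps)
  also have "\<dots> = g 0 - g (p ^ n)"
    by (rule sum_lessThan_telescope')
  also have "\<dots> = f 0 + w ^ (p ^ n) * f (of_nat (p ^ n))"
    using odd by (simp add: g_def power_minus[of w])
  finally show ?thesis
    unfolding fs w_def[symmetric] mult.left_commute[of w] distrib_left[symmetric] by (rule arg_cong)
qed

locale fermionic =
  fixes p :: nat and q \<zeta> :: "'a :: nonarch_valued_field"
  assumes odd: "odd p"
    and p: "absval (of_nat p :: 'a) < 1"
    and q: "absval (q - 1) < 1"
    and \<zeta>: "absval (\<zeta> - 1) < 1"
begin

lemma absval_2: "absval (2 :: 'a) = 1"
  using absval_two[OF odd p] .

lemma q_zeta: "absval (q * \<zeta> - 1) < 1"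
  using q \<zeta> by (rule absval_mult_diff_1_less)

lemma one_plus_q_zeta_nonzero: "1 + q * \<zeta> \<noteq> 0"
  using absval_one_plus[OF absval_2 q_zeta] by auto

lemma shift_tendsto:
  "(\<lambda>n. q * \<zeta> * fermionic_sum p q \<zeta> (\<lambda>\<xi>. (\<xi> + 1) ^ m) n + fermionic_sum p q \<zeta> (\<lambda>\<xi>. \<xi> ^ m) n)
    \<longlonglongrightarrow> (1 + q) * 0 ^ m"
proof -
  have "(\<lambda>n. inverse (1 + q ^ (p ^ n))) \<longlonglongrightarrow> inverse (1 + 1)"
    using absval_2 absval_one_plus[OF absval_2 absval_power_diff_1_less[OF q]]
    by (intro tendsto_inverse_nonarch tendsto_add tendsto_const
        power_prime_power_tendsto_1[OF p q]) simp_all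
  moreover have "(\<lambda>n. of_nat (p ^ n) ^ m :: 'a) \<longlonglongrightarrow> 0 ^ m"
  proof (induction m)
    case (Suc m)
    then show ?case
      unfolding power_Suc by (intro tendsto_mult prime_power_tendsto_0[OF p])
  qed simp
  ultimately have "(\<lambda>n. (1 + q) * inverse (1 + q ^ (p ^ n)) *
      (0 ^ m + (q * \<zeta>) ^ (p ^ n) * of_nat (p ^ n) ^ m))
    \<longlonglongrightarrow> (1 + q) * inverse (1 + 1) * (0 ^ m + 1 * 0 ^ m)"
    by (intro tendsto_mult tendsto_add tendsto_const power_prime_power_tendsto_1[OF p q_zeta])
  \<comment> \<open>For \<open>m = 0\<close> the two boundary terms add up to 2 and cancel the
    factor 1/2; for \<open>m > 0\<close> both vanish.\<close>
  moreover have "(1 + q) * inverse (1 + 1) * (0 ^ m + 1 * 0 ^ m) = (1 + q) * 0 ^ m"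
    by (simp add: field_simps)
  ultimately show ?thesis
    unfolding fermionic_sum_shift[OF odd, of q \<zeta> "\<lambda>\<xi>. \<xi> ^ m"] by simp
qed

lemma fermionic_sum_shifted_power:
  "fermionic_sum p q \<zeta> (\<lambda>\<xi>. (\<xi> + 1) ^ m) n
    = (\<Sum>k\<le>m. of_nat (m choose k) * fermionic_sum p q \<zeta> (\<lambda>\<xi>. \<xi> ^ k) n)"
  by (simp add: binomial_ring fermionic_sum_sum)

lemma moment_convergent: "convergent (fermionic_sum p q \<zeta> (\<lambda>\<xi>. \<xi> ^ m))"
proof (induction m rule: less_induct)
  case (less m)
  let ?S = "\<lambda>k. fermionic_sum p q \<zeta> (\<lambda>\<xi>. \<xi> ^ k)"
  let ?w = "q * \<zeta>"
  \<comment> \<open>The top binomial term \<open>k = m\<close> is \<open>?S m n\<close> itself.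
    Collecting it gives the coefficient \<open>1 + ?w\<close>, and division expresses
    \<open>?S m n\<close> by the convergent shift combination and lower moments.\<close>
  have solve: "?S m n = inverse (1 + ?w) * ((?w * fermionic_sum p q \<zeta> (\<lambda>\<xi>. (\<xi> + 1) ^ m) n + ?S m n)
      + (- ?w) * (\<Sum>k<m. of_nat (m choose k) * ?S k n))" for n
  proof -
    have "(?w * fermionic_sum p q \<zeta> (\<lambda>\<xi>. (\<xi> + 1) ^ m) n + ?S m n)
        + (- ?w) * (\<Sum>k<m. of_nat (m choose k) * ?S k n) = (1 + ?w) * ?S m n"
      by (simp add: fermionic_sum_shifted_power lessThan_Suc_atMost[symmetric] algebra_simps)
    then show ?thesis
      using one_plus_q_zeta_nonzero by (simp add: mult.assoc[symmetric])
  qed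
  have "?S k \<longlonglongrightarrow> lim (?S k)" if "k < m" for k
    using less[OF that] by (simp add: convergent_LIMSEQ_iff)
  then have "(\<lambda>n. inverse (1 + ?w) * ((?w * fermionic_sum p q \<zeta> (\<lambda>\<xi>. (\<xi> + 1) ^ m) n + ?S m n)
      + (- ?w) * (\<Sum>k<m. of_nat (m choose k) * ?S k n))) \<longlonglongrightarrow>
      inverse (1 + ?w) * ((1 + q) * 0 ^ m + (- ?w) * (\<Sum>k<m. of_nat (m choose k) * lim (?S k)))"
    by (intro tendsto_mult tendsto_add tendsto_sum tendsto_const shift_tendsto) auto
  then show ?case
    unfolding solve[symmetric] by (rule convergentI)
qed

lemma moment_tendsto:
  "fermionic_sum p q \<zeta> (\<lambda>\<xi>. \<xi> ^ m) \<longlonglongrightarrow> fermionic_integral p q \<zeta> (\<lambda>\<xi>. \<xi> ^ m)"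
  using moment_convergent by (simp add: convergent_LIMSEQ_iff fermionic_integral_def)

lemma moment_recursion:
  "q * \<zeta> * (\<Sum>k\<le>m. of_nat (m choose k) * fermionic_integral p q \<zeta> (\<lambda>\<xi>. \<xi> ^ k))
    + fermionic_integral p q \<zeta> (\<lambda>\<xi>. \<xi> ^ m) = (1 + q) * 0 ^ m"
proof (rule LIMSEQ_unique)
  show "(\<lambda>n. q * \<zeta> * fermionic_sum p q \<zeta> (\<lambda>\<xi>. (\<xi> + 1) ^ m) n + fermionic_sum p q \<zeta> (\<lambda>\<xi>. \<xi> ^ m) n)
    \<longlonglongrightarrow> q * \<zeta> * (\<Sum>k\<le>m. of_nat (m choose k) * fermionic_integral p q \<zeta> (\<lambda>\<xi>. \<xi> ^ k))
      + fermionic_integral p q \<zeta> (\<lambda>\<xi>. \<xi> ^ m)"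
    unfolding fermionic_sum_shifted_power
    by (intro tendsto_mult tendsto_add tendsto_sum tendsto_const moment_tendsto)
qed (rule shift_tendsto)

lemma fermionic_integral_exp_eq: "fermionic_integral_exp p q \<zeta> = q_euler_series q \<zeta>"
proof -
  let ?h = "fermionic_integral_exp p q \<zeta>"
  let ?d = "fps_const (q * \<zeta>) * fps_exp 1 + 1"
  have "?h * ?d = fps_const (1 + q)"
  proof (rule fps_ext)
    fix m
    \<comment> \<open>The Cauchy product with the exponential series is a binomial convolution of
      the moments: \<open>1 / (fact k * fact (m - k))\<close> equals
      \<open>of_nat (m choose k) / fact m\<close>.\<close>
    have "fps_nth (?h * fps_exp 1) m
        = (\<Sum>k\<le>m. of_nat (m choose k) * fermionic_integral p q \<zeta> (\<lambda>\<xi>. \<xi> ^ k)) / fact m"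
      unfolding fps_mult_nth atLeast0AtMost sum_divide_distrib
      by (intro sum.cong refl) (simp add: fermionic_integral_exp_def binomial_fact)
    moreover have "?h * ?d = fps_const (q * \<zeta>) * (?h * fps_exp 1) + ?h"
      by (simp add: algebra_simps)
    ultimately have "fps_nth (?h * ?d) m
        = (q * \<zeta> * (\<Sum>k\<le>m. of_nat (m choose k) * fermionic_integral p q \<zeta> (\<lambda>\<xi>. \<xi> ^ k))
          + fermionic_integral p q \<zeta> (\<lambda>\<xi>. \<xi> ^ m)) / fact m"
      by (simp add: fermionic_integral_exp_def add_divide_distrib)
    also have "\<dots> = fps_nth (fps_const (1 + q)) m"
      unfolding moment_recursion by (cases m) auto
    finally show "fps_nth (?h * ?d) m = fps_nth (fps_const (1 + q)) m" .
  qed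
  \<comment> \<open>The constant coefficient is \<open>1 + q * \<zeta>\<close>, so \<open>?d\<close>
    is a unit and division by it is multiplication by its inverse.\<close>
  moreover have "fps_nth ?d 0 \<noteq> 0"
    using one_plus_q_zeta_nonzero by (simp add: add.commute)
  ultimately have "?h = fps_const (1 + q) * inverse ?d"
    by (metis inverse_mult_eq_1' mult.assoc mult.right_neutral)
  also have "\<dots> = q_euler_series q \<zeta>"
    using \<open>fps_nth ?d 0 \<noteq> 0\<close> by (simp add: q_euler_series_def fps_divide_unit)
  finally show ?thesis .
qed

end

subsection \<open>Umbral calculus\<close>

text \<open>The falling factorial is written as a quotient of factorials to match the coefficients
  \<open>1 / fact (n - k)\<close> of the series of \<open>exp (t x)\<close>.\<close>

lemma pderiv_funpow_monom:
  fixes c :: "'a :: field_char_0"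
  assumes "k \<le> n"
  shows "(pderiv ^^ k) (monom c n) = monom (c * fact n / fact (n - k)) (n - k)"
  using assms
proof (induction k)
  case (Suc k)
  then obtain d where d: "n = Suc k + d"
    using le_Suc_ex by blast
  have "(pderiv ^^ Suc k) (monom c n) = pderiv (monom (c * fact n / fact (Suc d)) (Suc d))"
    using Suc d by simp
  also have "\<dots> = monom (c * fact n / fact d) d"
    by (simp add: pderiv_monom del: of_nat_Suc)
  finally show ?case
    by (simp add: d)
qed simp

lemma smult_sum_right: "smult c (sum f A) = (\<Sum>i\<in>A. smult c (f i))"
  by (induction A rule: infinite_finite_induct) (simp_all add: smult_add_right)

lemma q_euler_poly_eq_umbral_op: "q_euler_poly q \<zeta> n = umbral_op (q_euler_series q \<zeta>) (monom 1 n)"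
proof -
  have "smult (fact n) ([:a:] * monom (1 / fact (n - k)) (n - k))
      = smult a ((pderiv ^^ k) (monom 1 n))" if "k \<le> n" for a :: 'a and k
    using that by (simp add: pderiv_funpow_monom smult_monom mult_ac)
  then show ?thesis
    by (simp add: q_euler_poly_def umbral_op_def fps_mult_nth degree_monom_eq smult_sum_right
        atLeast0AtMost)
qed

text \<open>The shifted polynomial \<open>?Q\<close> is expanded in powers of \<open>y\<close>; its
  coefficients are its derivatives at 0 over \<open>fact k\<close>, and these are the derivatives of
  \<open>P\<close> at \<open>x\<close> because the inner derivative is 1.\<close>

lemma poly_taylor:
  fixes P :: "'a :: field_char_0 poly"
  shows "poly P (x + y) = (\<Sum>k\<le>degree P. poly ((pderiv ^^ k) P) x / fact k * y ^ k)"
proof -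
  let ?Q = "pcompose P [:x, 1:]"
  have coeff: "coeff ?Q k = poly ((pderiv ^^ k) P) x / fact k" for k
  proof -
    have "(pderiv ^^ k) ?Q = pcompose ((pderiv ^^ k) P) [:x, 1:]"
      by (induction k) (simp_all add: pderiv_pcompose pderiv_pCons)
    then have "poly ((pderiv ^^ k) P) x = poly ((pderiv ^^ k) ?Q) 0"
      by (simp add: poly_pcompose)
    also have "\<dots> = fact k * coeff ?Q k"
      by (simp add: poly_0_coeff_0 coeff_higher_pderiv pochhammer_fact[symmetric])
    finally show ?thesis
      by simp
  qed
  have "poly P (x + y) = poly ?Q y"
    by (simp add: poly_pcompose)
  also have "\<dots> = (\<Sum>k\<le>degree ?Q. coeff ?Q k * y ^ k)"
    by (rule poly_altdef)
  also have "degree ?Q = degree P"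
    by (simp add: degree_pcompose)
  finally show ?thesis
    unfolding coeff .
qed

text \<open>Taylor expansion in \<open>\<xi>\<close> reduces the sum to finitely many moments, and
  moment over \<open>fact k\<close> is the coefficient by which \<open>umbral_op\<close> weights the
  \<open>k\<close>-th derivative. This gives existence and value of the integral at once.\<close>

lemma (in fermionic) fermionic_sum_poly_tendsto:
  "fermionic_sum p q \<zeta> (\<lambda>\<xi>. poly P (x + \<xi>))
    \<longlonglongrightarrow> poly (umbral_op (fermionic_integral_exp p q \<zeta>) P) x"
proof -
  have "(\<lambda>n. \<Sum>k\<le>degree P. poly ((pderiv ^^ k) P) x / fact k * fermionic_sum p q \<zeta> (\<lambda>\<xi>. \<xi> ^ k) n)
    \<longlonglongrightarrow> (\<Sum>k\<le>degree P. poly ((pderiv ^^ k) P) x / fact k * fermionic_integral p q \<zeta> (\<lambda>\<xi>. \<xi> ^ k))"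
    by (intro tendsto_sum tendsto_mult tendsto_const moment_tendsto)
  also have "(\<Sum>k\<le>degree P. poly ((pderiv ^^ k) P) x / fact k * fermionic_integral p q \<zeta> (\<lambda>\<xi>. \<xi> ^ k))
    = poly (umbral_op (fermionic_integral_exp p q \<zeta>) P) x"
    by (simp add: umbral_op_def fermionic_integral_exp_def poly_sum mult.commute)
  finally show ?thesis
    unfolding poly_taylor fermionic_sum_sum[symmetric] .
qed

theorem theorem4:
  fixes p :: nat and q \<zeta> :: "'a :: nonarch_valued_field"
  assumes "prime p" and "odd p"
    and "padic_complex_field p TYPE('a)"
    and "absval (q - 1) < 1" and "absval (1 - \<zeta>) < 1"
  shows "(\<forall>(P :: 'a poly) (x :: 'a).
            fermionic_integrable p q \<zeta> (\<lambda>\<xi>. poly P (x + \<xi>)) \<and>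
            fermionic_integral p q \<zeta> (\<lambda>\<xi>. poly P (x + \<xi>))
              = poly (umbral_op (fermionic_integral_exp p q \<zeta>) P) x \<and>
            poly (umbral_op (fermionic_integral_exp p q \<zeta>) P) x
              = poly (umbral_op (q_euler_series q \<zeta>) P) x) \<and>
         (\<forall>n. q_euler_poly q \<zeta> n = umbral_op (fermionic_integral_exp p q \<zeta>) (monom 1 n) \<and>
              umbral_op (fermionic_integral_exp p q \<zeta>) (monom 1 n)
                = umbral_op (q_euler_series q \<zeta>) (monom 1 n))"
proof -
  interpret fermionic p q \<zeta>
    using assms absval_prime_less_1[OF assms(1,3)]
    by unfold_locales (simp_all add: absval_minus_commute)
  show ?thesis
    using fermionic_sum_poly_tendsto
    by (auto simp: fermionic_integrable_def fermionic_integral_def q_euler_poly_eq_umbral_op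
        fermionic_integral_exp_eq intro: convergentI limI)
qed

end
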